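(* A ternary form $f$ over $\mathbb{C}$ of degree at most 4 has Clebsch covariant $S(f)$ identically zero if and only if $f$ lies in the closure of the set of ternary forms (of the same degree) which can be written as $\alpha(x,y)+\beta(z)$ in some linear coordinates $(x,y,z)$.
   Context: For a ternary form $f(x_1,x_2,x_3)$ write $f_{ijk}=\partial^3 f/\partial x_i\partial x_j\partial x_k$ and set $a_3=f_{333}$, $a_2=f_{133}$, $b_2=f_{233}$, $a_1=f_{113}$, $b_1=f_{123}$, $c_1=f_{223}$, $a_0=f_{111}$, $b_0=f_{112}$, $c_0=f_{122}$, $d_0=f_{222}$. The Clebsch covariant is the polynomial $S(f)=-(a_0a_2-a_1^2)c_1^2+(a_0a_3-a_1a_2)c_0c_1-(a_1a_3-a_2^2)c_0^2-b_0^2a_3c_1+b_0b_1(3a_2c_1+a_3c_0)-(b_0b_2+2b_1^2)(a_1c_1+a_2c_0)+b_1b_2(a_0c_1+3a_1c_0)-b_2^2a_0c_0+d_0[b_0(a_1a_3-a_2^2)-b_1(a_0a_3-a_1a_2)+b_2(a_0a_2-a_1^2)]+(b_0b_2-b_1^2)^2.$ "In some linear coordinates" means after a change of variables by an element of $GL(3,\mathbb{C})$. *)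

theory Defs
  imports "HOL-Analysis.Analysis"
begin

text \<open>A ternary form of degree d over the complex numbers is represented by its
coefficient function: c (i,j,k) is the coefficient of x1^i x2^j x3^k; it must vanish
unless i+j+k = d.  The space of such functions carries the product (pointwise)
topology, which on the finite-dimensional space of degree-d forms is the usual
Euclidean topology.\<close>

type_synonym tform = "nat \<times> nat \<times> nat \<Rightarrow> complex"

definition is_form :: "nat \<Rightarrow> tform \<Rightarrow> bool" where
  "is_form d c \<longleftrightarrow> (\<forall>i j k. i + j + k \<noteq> d \<longrightarrow> c (i, j, k) = 0)"

definition feval :: "nat \<Rightarrow> tform \<Rightarrow> complex^3 \<Rightarrow> complex" where
  "feval d c v = (\<Sum>i\<le>d. \<Sum>j\<le>d - i.
      c (i, j, d - i - j) * (v$1) ^ i * (v$2) ^ j * (v$3) ^ (d - i - j))"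

definition pd :: "nat \<Rightarrow> tform \<Rightarrow> tform" where
  "pd m c = (\<lambda>(i, j, k).
      if m = 1 then of_nat (Suc i) * c (Suc i, j, k)
      else if m = 2 then of_nat (Suc j) * c (i, Suc j, k)
      else of_nat (Suc k) * c (i, j, Suc k))"

definition d3 :: "nat \<Rightarrow> tform \<Rightarrow> nat \<Rightarrow> nat \<Rightarrow> nat \<Rightarrow> complex^3 \<Rightarrow> complex" where
  "d3 d f a b c v = feval (d - 3) (pd a (pd b (pd c f))) v"

definition clebsch :: "nat \<Rightarrow> tform \<Rightarrow> complex^3 \<Rightarrow> complex" where
  "clebsch d f v =
    (let a3 = d3 d f 3 3 3 v; a2 = d3 d f 1 3 3 v; b2 = d3 d f 2 3 3 v;
         a1 = d3 d f 1 1 3 v; b1 = d3 d f 1 2 3 v; c1 = d3 d f 2 2 3 v;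
         a0 = d3 d f 1 1 1 v; b0 = d3 d f 1 1 2 v; c0 = d3 d f 1 2 2 v;
         d0 = d3 d f 2 2 2 v in
     - (a0*a2 - a1^2)*c1^2 + (a0*a3 - a1*a2)*c0*c1 - (a1*a3 - a2^2)*c0^2
     - b0^2*a3*c1 + b0*b1*(3*a2*c1 + a3*c0) - (b0*b2 + 2*b1^2)*(a1*c1 + a2*c0)
     + b1*b2*(a0*c1 + 3*a1*c0) - b2^2*a0*c0
     + d0*(b0*(a1*a3 - a2^2) - b1*(a0*a3 - a1*a2) + b2*(a0*a2 - a1^2))
     + (b0*b2 - b1^2)^2)"

definition split_form :: "nat \<Rightarrow> tform \<Rightarrow> bool" where
  "split_form d g \<longleftrightarrow> (\<exists>A :: complex^3^3. invertible A \<and>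
     (\<exists>(\<alpha> :: nat \<Rightarrow> complex) (b :: complex). \<forall>v.
        feval d g (A *v v) = (\<Sum>i\<le>d. \<alpha> i * (v$1) ^ i * (v$2) ^ (d - i)) + b * (v$3) ^ d))"

end

theory Submission
  imports Defs "HOL-Computational_Algebra.Fundamental_Theorem_Algebra"
begin

text \<open>
  Both conditions are equivalent, in degree at least 1, to the existence of a direction \<open>u\<close> such that
  the derivative \<open>D_u f\<close> is a multiple of a power \<open>n^(d-1)\<close> of a linear form. If \<open>n(u) \<noteq> 0\<close>, integrating
  along \<open>u\<close> gives \<open>f = \<alpha>(x, y) + \<beta> z^d\<close> with \<open>u\<close> as third basis vector; if \<open>n(u) = 0\<close>, it gives
  \<open>f = \<alpha>(x, y) + \<beta> z x^(d-1)\<close>, a limit of split forms.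

  To find \<open>u\<close> when \<open>S(f) = 0\<close>, evaluate \<open>S\<close> in an adapted basis, which is allowed because \<open>S\<close> is an
  invariant of the polar cubics. For a cubic, take \<open>u\<close> on the Hessian curve and \<open>w\<close> in the kernel of
  the Hessian matrix at \<open>u\<close>. If \<open>u\<close> and \<open>w\<close> are independent, \<open>S\<close> becomes the product of the two minors
  that vanish exactly when the conic \<open>D_u f\<close> or \<open>D_w f\<close> is a double line; if they are proportional, it
  becomes the square of such a minor. For a quartic, the same choice for the second polar \<open>D_v D_v f\<close>
  annihilates so many coefficients that the identity \<open>S(f) = 0\<close> can be solved case by case.
\<close>

section \<open>Bases of the coordinate space\<close>

definition det3 :: "complex^3 \<Rightarrow> complex^3 \<Rightarrow> complex^3 \<Rightarrow> complex" where
  "det3 p q r = p$1 * (q$2 * r$3 - q$3 * r$2) - p$2 * (q$1 * r$3 - q$3 * r$1)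
     + p$3 * (q$1 * r$2 - q$2 * r$1)"

definition dot3 :: "complex^3 \<Rightarrow> complex^3 \<Rightarrow> complex" where
  "dot3 n a = n$1 * a$1 + n$2 * a$2 + n$3 * a$3"

lemma dot3_add: "dot3 n (a + b) = dot3 n a + dot3 n b"
  and dot3_diff: "dot3 n (a - b) = dot3 n a - dot3 n b"
  and dot3_scale: "dot3 n (k *s a) = k * dot3 n a"
  by (simp_all add: dot3_def algebra_simps)

lemma det3_swap12: "det3 q p r = - det3 p q r"
  and det3_swap23: "det3 p r q = - det3 p q r"
  by (simp_all add: det3_def algebra_simps)

lemma det3_comb:
  "det3 (x *s p + y *s q + z *s r) q r = x * det3 p q r"
  "det3 p (x *s p + y *s q + z *s r) r = y * det3 p q r"
  "det3 p q (x *s p + y *s q + z *s r) = z * det3 p q r"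
  by (simp_all add: det3_def algebra_simps)

lemma det3_shear:
  "det3 p (q - k *s p) r = det3 p q r" "det3 p (q - k *s r) r = det3 p q r"
  "det3 p q (r - k *s p) = det3 p q r" "det3 p q (r - k *s q) = det3 p q r"
  "det3 (p - k *s r) q r = det3 p q r"
  by (simp_all add: det3_def algebra_simps)

lemma det3_zero [simp]: "det3 0 q r = 0" "det3 p 0 r = 0" "det3 p q 0 = 0"
  by (simp_all add: det3_def)

lemma det3_std [simp]: "det3 (vector [1,0,0]) (vector [0,1,0]) (vector [0,0,1]) = 1"
  by (simp add: det3_def)

lemma basis_expand:
  assumes "det3 p q r \<noteq> 0"
  obtains x y z where "v = x *s p + y *s q + z *s r"
proof
  show "v = (det3 v q r / det3 p q r) *s p + (det3 p v r / det3 p q r) *s q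
              + (det3 p q v / det3 p q r) *s r"
    using assms
    by (simp add: vec_eq_iff forall_3 divide_simps) (simp add: det3_def, algebra)
qed

lemma basis_indep:
  assumes "det3 p q r \<noteq> 0" "x *s p + y *s q + z *s r = 0"
  shows "x = 0 \<and> y = 0 \<and> z = 0"
  using det3_comb[where x=x and y=y and z=z and p=p and q=q and r=r, unfolded assms(2)] assms(1) by simp

lemma basis_functional:
  assumes "det3 p q r \<noteq> 0"
  obtains n where "dot3 n p = (x::complex)" "dot3 n q = y" "dot3 n r = z"
proof
  \<comment> \<open>The bracketed vectors are the cross products of \<open>q, r\<close>, of
    \<open>r, p\<close> and of \<open>p, q\<close>; divided by the determinant they form the dual
    basis.\<close>
  define n :: "complex^3" where "n = (1 / det3 p q r) *s
    (x *s vector [q$2*r$3-q$3*r$2, q$3*r$1-q$1*r$3, q$1*r$2-q$2*r$1]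
   + y *s vector [r$2*p$3-r$3*p$2, r$3*p$1-r$1*p$3, r$1*p$2-r$2*p$1]
   + z *s vector [p$2*q$3-p$3*q$2, p$3*q$1-p$1*q$3, p$1*q$2-p$2*q$1])"
  show "dot3 n p = x" "dot3 n q = y" "dot3 n r = z"
    using assms
    by (simp_all add: n_def dot3_def divide_simps) (simp_all add: det3_def, algebra+)
qed

lemma basis_ext1:
  assumes "p \<noteq> 0"
  obtains q r where "det3 p q r \<noteq> 0"
proof -
  have "p$1 \<noteq> 0 \<or> p$2 \<noteq> 0 \<or> p$3 \<noteq> 0"
    using assms by (auto simp: vec_eq_iff forall_3)
  moreover have "det3 p (vector [0,1,0]) (vector [0,0,1]) = p$1"
    "det3 p (vector [1,0,0]) (vector [0,0,1]) = - p$2"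
    "det3 p (vector [1,0,0]) (vector [0,1,0]) = p$3"
    by (simp_all add: det3_def)
  ultimately show thesis
    by (metis that neg_equal_0_iff_equal)
qed

text \<open>A vector off the line of \<open>p\<close> has a nonzero coordinate along
  \<open>b\<close> or \<open>c\<close>, and the other one of these two completes the basis.\<close>

lemma basis_ext2:
  assumes "p \<noteq> 0" "\<And>k. q \<noteq> k *s p"
  obtains r where "det3 p q r \<noteq> 0"
proof -
  obtain b c where bc: "det3 p b c \<noteq> 0"
    using basis_ext1[OF assms(1)] .
  obtain x y z where q: "q = x *s p + y *s b + z *s c"
    using basis_expand[OF bc] .
  have "y \<noteq> 0 \<or> z \<noteq> 0"
    using assms(2)[of x] q by auto
  moreover have "det3 p q c = y * det3 p b c" "det3 p q b = - z * det3 p b c"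
    by (simp_all add: q det3_def algebra_simps)
  ultimately show thesis
    using bc that by (metis mult_eq_0_iff neg_equal_0_iff_equal)
qed

lemma det_zero_kernel:
  fixes N :: "complex^3^3"
  assumes "det N = 0"
  obtains w where "w \<noteq> 0" "N *v w = 0"
proof -
  have "\<not> (\<exists>B. B ** N = mat 1)"
    using assms invertible_det_nz[of N] invertible_left_inverse[of N] by blast
  then show thesis
    using that matrix_left_invertible_ker[of N] by auto
qed

section \<open>The Aronhold invariant of a symmetric trilinear form\<close>

text \<open>
  The ten arguments are the values of a symmetric trilinear form on three vectors \<open>p\<close>, \<open>q\<close>, \<open>r\<close>,
  named as the third derivatives in the definition of the Clebsch covariant with \<open>p\<close>, \<open>q\<close>, \<open>r\<close> in
  the role of the directions 1, 2, 3.
\<close>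

definition aronhold ::
  "complex \<Rightarrow> complex \<Rightarrow> complex \<Rightarrow> complex \<Rightarrow> complex \<Rightarrow> complex \<Rightarrow> complex \<Rightarrow>
   complex \<Rightarrow> complex \<Rightarrow> complex \<Rightarrow> complex" where
  "aronhold a0 a1 a2 a3 b0 b1 b2 c0 c1 d0 =
     - (a0*a2 - a1^2)*c1^2 + (a0*a3 - a1*a2)*c0*c1 - (a1*a3 - a2^2)*c0^2
     - b0^2*a3*c1 + b0*b1*(3*a2*c1 + a3*c0) - (b0*b2 + 2*b1^2)*(a1*c1 + a2*c0)
     + b1*b2*(a0*c1 + 3*a1*c0) - b2^2*a0*c0
     + d0*(b0*(a1*a3 - a2^2) - b1*(a0*a3 - a1*a2) + b2*(a0*a2 - a1^2))
     + (b0*b2 - b1^2)^2"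

definition aron :: "(complex^3 \<Rightarrow> complex^3 \<Rightarrow> complex^3 \<Rightarrow> complex) \<Rightarrow>
    complex^3 \<Rightarrow> complex^3 \<Rightarrow> complex^3 \<Rightarrow> complex" where
  "aron T p q r = aronhold (T p p p) (T p p r) (T p r r) (T r r r) (T p p q) (T p q r) (T q r r)
     (T p q q) (T q q r) (T q q q)"

locale sym_bilinear =
  fixes B :: "complex^3 \<Rightarrow> complex^3 \<Rightarrow> complex"
  assumes swap: "B a b = B b a"
    and add1: "B (a + a') b = B a b + B a' b"
    and scale1: "B (k *s a) b = k * B a b"
begin

lemma add2: "B a (b + b') = B a b + B a b'"
  by (metis swap add1)

lemma scale2: "B a (k *s b) = k * B a b"
  by (metis swap scale1)

text \<open>Since \<open>s\<close> lies in the radical, \<open>B\<close> lives on the plane of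
  \<open>y\<close> and \<open>z\<close>, where \<open>hess\<close> is a vanishing discriminant. The
  rank is therefore at most 1, and a symmetric form of rank at most 1 is a multiple of a
  square.\<close>

lemma square_if_degenerate:
  assumes basis: "det3 s y z \<noteq> 0"
    and s: "B s s = 0" "B s y = 0" "B s z = 0"
    and hess: "B y y * B z z = (B y z)\<^sup>2"
  obtains n k where "n \<noteq> 0" "\<And>a b. B a b = k * dot3 n a * dot3 n b"
proof -
  obtain k m l where kml: "B y y = k * m^2" "B y z = k * m * l" "B z z = k * l^2" "m \<noteq> 0 \<or> l \<noteq> 0"
  proof (cases "B y y = 0")
    case True
    with hess show thesis using that[of "B z z" 0 1] by simp
  next
    case False
    with hess show thesis using that[of "B y y" 1 "B y z / B y y"]
      by (simp add: field_simps power2_eq_square)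
  qed
  obtain n where n: "dot3 n s = 0" "dot3 n y = m" "dot3 n z = l"
    using basis_functional[OF basis] .
  show thesis
  proof
    show "n \<noteq> 0" using n kml(4) by (auto simp: dot3_def)
    fix a b
    obtain a1 a2 a3 where a: "a = a1 *s s + a2 *s y + a3 *s z"
      using basis_expand[OF basis] .
    obtain b1 b2 b3 where b: "b = b1 *s s + b2 *s y + b3 *s z"
      using basis_expand[OF basis] .
    have "B y s = 0" "B z s = 0" "B z y = k * m * l" using s kml swap by metis+
    then show "B a b = k * dot3 n a * dot3 n b"
      by (simp add: a b add1 add2 scale1 scale2 s kml dot3_add dot3_scale n)
         (simp add: algebra_simps power2_eq_square)
  qed
qed

end

locale sym_trilinear =
  fixes T :: "complex^3 \<Rightarrow> complex^3 \<Rightarrow> complex^3 \<Rightarrow> complex"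
  assumes swap12: "T a b c = T b a c" and swap23: "T a b c = T a c b"
    and add1: "T (a + a') b c = T a b c + T a' b c"
    and scale1: "T (k *s a) b c = k * T a b c"
begin

lemma add2: "T a (b + b') c = T a b c + T a b' c"
  by (metis swap12 add1)

lemma scale2: "T a (k *s b) c = k * T a b c"
  by (metis swap12 scale1)

lemma add3: "T a b (c + c') = T a b c + T a b c'"
  by (metis swap23 add2)

lemma scale3: "T a b (k *s c) = k * T a b c"
  by (metis swap23 scale2)

lemmas expand = add1 add2 add3 scale1 scale2 scale3

lemma diff1: "T (a - a') b c = T a b c - T a' b c"
  using add1[of "a - a'" a'] by simp

lemma diff2: "T a (b - b') c = T a b c - T a b' c"
  using add2[of a "b - b'" b'] by simp

lemma diff3: "T a b (c - c') = T a b c - T a b c'"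
  using add3[of a b "c - c'" c'] by simp

sublocale slot: sym_bilinear "T u" for u
  by standard (use swap23 add2 scale2 in auto)

lemma aron_swap12: "aron T q p r = aron T p q r"
  by (simp add: aron_def swap12 swap23) (simp add: aronhold_def, algebra)

lemma aron_swap23: "aron T p r q = aron T p q r"
  by (simp add: aron_def swap12 swap23) (simp add: aronhold_def, algebra)

text \<open>The Aronhold invariant has weight 4: a change of basis multiplies it by the fourth power
  of the determinant, which is \<open>x\<close> for this exchange.\<close>

lemma aron_comb: "aron T (x *s p + y *s q + z *s r) q r = x ^ 4 * aron T p q r"
proof -
  have *: "aronhold
     (x^3*a0+3*x^2*y*b0+3*x^2*z*a1+3*x*y^2*c0+6*x*y*z*b1+3*x*z^2*a2+y^3*d0+3*y^2*z*c1+3*y*z^2*b2+z^3*a3)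
     (x^2*a1+2*x*y*b1+2*x*z*a2+y^2*c1+2*y*z*b2+z^2*a3)
     (x*a2+y*b2+z*a3) a3
     (x^2*b0+2*x*y*c0+2*x*z*b1+y^2*d0+2*y*z*c1+z^2*b2)
     (x*b1+y*c1+z*b2) b2
     (x*c0+y*d0+z*c1) c1 d0 = x^4 * aronhold a0 a1 a2 a3 b0 b1 b2 c0 c1 d0"
    for a0 a1 a2 a3 b0 b1 b2 c0 c1 d0
    unfolding aronhold_def by algebra
  define P where "P = x *s p + y *s q + z *s r"
  have 1: "T P a b = x * T p a b + y * T q a b + z * T r a b"
    "T a P b = x * T a p b + y * T a q b + z * T a r b"
    "T a b P = x * T a b p + y * T a b q + z * T a b r" for a b
    by (simp_all add: P_def expand)
  have 2: "T P P P = x^3*T p p p+3*x^2*y*T p p q+3*x^2*z*T p p r+3*x*y^2*T p q q+6*x*y*z*T p q r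
       +3*x*z^2*T p r r+y^3*T q q q+3*y^2*z*T q q r+3*y*z^2*T q r r+z^3*T r r r"
    "T P P r = x^2*T p p r+2*x*y*T p q r+2*x*z*T p r r+y^2*T q q r+2*y*z*T q r r+z^2*T r r r"
    "T P P q = x^2*T p p q+2*x*y*T p q q+2*x*z*T p q r+y^2*T q q q+2*y*z*T q q r+z^2*T q r r"
    "T P q q = x*T p q q+y*T q q q+z*T q q r"
    by (simp_all add: 1 swap12 swap23 algebra_simps power2_eq_square power3_eq_cube)
  have 3: "T P r r = x*T p r r + y*T q r r + z*T r r r" "T P q r = x*T p q r+y*T q q r+z*T q r r"
    by (simp_all add: 1 swap12 swap23)
  show ?thesis
    unfolding aron_def P_def[symmetric] 2 3 * ..
qed

text \<open>
  Stands in for the \<open>GL(3)\<close>-invariance of the Aronhold invariant: \<open>aron_comb\<close> lets one vector of a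
  basis be exchanged for another, and finitely many exchanges connect any two bases.
\<close>

lemma aron_eq_0_any_basis:
  assumes "det3 p q r \<noteq> 0" "aron T p q r = 0" "det3 a b c \<noteq> 0"
  shows "aron T a b c = 0"
proof -
  have first: "aron T a q r = 0" if pqr: "det3 p q r \<noteq> 0" "aron T p q r = 0" for a p q r
  proof -
    obtain x y z where "a = x *s p + y *s q + z *s r"
      using basis_expand[OF pqr(1)] .
    then show ?thesis using pqr(2) by (simp add: aron_comb)
  qed
  have second: "aron T p a r = 0" if "det3 p q r \<noteq> 0" "aron T p q r = 0" for a p q r
    using first[of q p r a] that by (simp add: aron_swap12[of q p] aron_swap12[of a p] det3_swap12[of q p])
  have third: "aron T p q a = 0" if "det3 p q r \<noteq> 0" "aron T p q r = 0" for a p q r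
    using second[of p r q a] that by (simp add: aron_swap23[of p r] aron_swap23[of p a] det3_swap23[of p r])
  \<comment> \<open>Steinitz exchange: \<open>a\<close> replaces a basis vector on which it has a
    nonzero coordinate and is then moved to the front. The same is done next for \<open>b\<close>,
    with \<open>a\<close> kept.\<close>
  have "\<exists>y z. det3 a y z \<noteq> 0 \<and> aron T a y z = 0"
  proof -
    obtain x y z where a: "a = x *s p + y *s q + z *s r"
      using basis_expand[OF assms(1)] .
    have 1: "det3 a q r = x * det3 p q r" "det3 a p r = - y * det3 p q r" "det3 a p q = z * det3 p q r"
      by (simp_all add: a det3_def algebra_simps)
    have 2: "x \<noteq> 0 \<or> y \<noteq> 0 \<or> z \<noteq> 0"
      using a assms(3) by auto
    have 3: "aron T a q r = 0" "aron T a p r = 0" "aron T a p q = 0"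
      using first[OF assms(1,2), of a] second[OF assms(1,2), of a] third[OF assms(1,2), of a]
        aron_swap12[of a p] aron_swap23[of p a q] by auto
    show ?thesis
      using 1 2 3 assms(1) by (metis mult_eq_0_iff neg_equal_0_iff_equal)
  qed
  then obtain y z where yz: "det3 a y z \<noteq> 0" "aron T a y z = 0"
    by blast
  have "\<exists>z'. det3 a b z' \<noteq> 0 \<and> aron T a b z' = 0"
  proof -
    obtain k l m where b: "b = k *s a + l *s y + m *s z"
      using basis_expand[OF yz(1)] .
    have 1: "det3 a b z = l * det3 a y z" "det3 a b y = - m * det3 a y z"
      by (simp_all add: b det3_def algebra_simps)
    have 2: "l \<noteq> 0 \<or> m \<noteq> 0"
      using b assms(3) by (auto simp: det3_def algebra_simps)
    have 3: "aron T a b z = 0" "aron T a b y = 0"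
      using second[OF yz, of b] third[OF yz, of b] aron_swap23[of a b y] by auto
    show ?thesis
      using 1 2 3 yz(1) by (metis mult_eq_0_iff neg_equal_0_iff_equal)
  qed
  then obtain z' where "det3 a b z' \<noteq> 0" "aron T a b z' = 0"
    by blast
  then show ?thesis
    by (rule third)
qed

text \<open>With \<open>s\<close> in the radical, \<open>T\<close> is a binary cubic in the
  directions \<open>y\<close> and \<open>z\<close>. The three equations are the vanishing
  coefficients of its Hessian, which characterises cubes of linear forms.\<close>

lemma cube_if_degenerate:
  assumes basis: "det3 s y z \<noteq> 0"
    and s: "T s s s = 0" "T s s y = 0" "T s s z = 0" "T s y y = 0" "T s y z = 0" "T s z z = 0"
    and hess: "T y y y * T y z z = (T y y z)\<^sup>2" "T y y y * T z z z = T y y z * T y z z"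
      "T y y z * T z z z = (T y z z)\<^sup>2"
  obtains n k where "n \<noteq> 0" "\<And>a b c. T a b c = k * dot3 n a * dot3 n b * dot3 n c"
proof -
  obtain k m l where kml: "T y y y = k * m^3" "T y y z = k * m^2 * l" "T y z z = k * m * l^2"
      "T z z z = k * l^3" "m \<noteq> 0 \<or> l \<noteq> 0"
  proof (cases "T y y y = 0")
    case True
    with hess show thesis using that[of "T z z z" 0 1] by simp
  next
    case False
    define l where "l = T y y z / T y y y"
    have 1: "T y y z = T y y y * l" using False by (simp add: l_def)
    then have 2: "T y z z = T y y y * l^2" using hess(1) False by (simp add: power2_eq_square)
    have "T z z z = T y y y * l^3"
      using hess(2) False unfolding 1 2 by (simp add: power2_eq_square power3_eq_cube)
    with 1 2 show thesis using that[of "T y y y" 1 l] by simp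
  qed
  obtain n where n: "dot3 n s = 0" "dot3 n y = m" "dot3 n z = l"
    using basis_functional[OF basis] .
  show thesis
  proof
    show "n \<noteq> 0" using n kml(5) by (auto simp: dot3_def)
    fix a b c
    obtain a1 a2 a3 where a: "a = a1 *s s + a2 *s y + a3 *s z"
      using basis_expand[OF basis] .
    obtain b1 b2 b3 where b: "b = b1 *s s + b2 *s y + b3 *s z"
      using basis_expand[OF basis] .
    obtain c1 c2 c3 where c: "c = c1 *s s + c2 *s y + c3 *s z"
      using basis_expand[OF basis] .
    have "T s u v = 0" for u v
    proof -
      obtain u1 u2 u3 where u: "u = u1 *s s + u2 *s y + u3 *s z"
        using basis_expand[OF basis] .
      obtain v1 v2 v3 where v: "v = v1 *s s + v2 *s y + v3 *s z"
        using basis_expand[OF basis] .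
      have "T s y s = 0" "T s z s = 0" "T s z y = 0" using s swap23 by metis+
      then show ?thesis by (simp add: u v expand s)
    qed
    then have 0: "T s u v = 0" "T u s v = 0" "T u v s = 0" for u v
      using swap12 swap23 by metis+
    have "T y z y = T y y z" "T z y y = T y y z" "T z y z = T y z z" "T z z y = T y z z"
      using swap12 swap23 by metis+
    then show "T a b c = k * dot3 n a * dot3 n b * dot3 n c"
      by (simp add: a b c expand 0 kml dot3_add dot3_scale n)
         (simp add: algebra_simps power2_eq_square power3_eq_cube)
  qed
qed

end

section \<open>Cubics\<close>

text \<open>The determinant is a polynomial in \<open>t\<close> whose coefficient at the sixth power
  is \<open>det C\<close>, so it is not constant and has a root.\<close>

lemma singular_in_pencil:
  fixes A B C :: "complex^3^3"
  assumes "det C \<noteq> 0"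
  obtains t where "det (\<chi> i j. A$i$j + t * B$i$j + t\<^sup>2 * C$i$j) = 0"
proof -
  define p where "p = det (\<chi> i j. [:A$i$j, B$i$j, C$i$j:])"
  have eval: "poly p t = det (\<chi> i j. A$i$j + t * B$i$j + t\<^sup>2 * C$i$j)" for t
    by (simp add: p_def det_3 power2_eq_square algebra_simps)
  have "coeff p 6 = det C"
    by (simp add: p_def det_3 eval_nat_numeral algebra_simps)
  then have "degree p \<noteq> 0"
    using assms coeff_eq_0[of p 6] by (metis gr0I zero_less_numeral)
  then have "\<not> constant (poly p)"
    by (simp add: constant_degree)
  then show thesis
    using fundamental_theorem_of_algebra[of p] that by (auto simp: eval)
qed

context sym_bilinear
begin

lemma kernel_if_det_zero:
  assumes "det (\<chi> i j. B (axis i 1) (axis j 1)) = 0"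
  obtains w where "w \<noteq> 0" "\<And>a. B w a = 0"
proof -
  have std: "a = a$1 *s axis 1 1 + a$2 *s axis 2 1 + a$3 *s axis 3 1" for a :: "complex^3"
    by (simp add: vec_eq_iff forall_3 axis_def)
  obtain w where w: "w \<noteq> 0" "(\<chi> i j. B (axis i 1) (axis j 1)) *v w = 0"
    using det_zero_kernel[OF assms] .
  have "B (axis i 1) w = 0" for i
  proof -
    have "B (axis i 1) w = ((\<chi> i j. B (axis i 1) (axis j 1)) *v w) $ i"
      by (subst std[of w]) (simp add: add2 scale2 matrix_vector_mult_def sum_3 mult.commute)
    then show ?thesis using w by simp
  qed
  then have "B w a = 0" for a
    by (subst std[of a]) (simp add: add2 scale2 swap[of w])
  then show thesis using that w by blast
qed

end

context sym_trilinear
begin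

lemma square_slot_if_aron_zero:
  assumes S: "\<And>a b c. det3 a b c \<noteq> 0 \<Longrightarrow> aron T a b c = 0"
  obtains u n k where "u \<noteq> 0" "n \<noteq> 0" "\<And>a b. T u a b = k * dot3 n a * dot3 n b"
proof -
  let ?H = "\<lambda>u. \<chi> i j. T u (axis i 1) (axis j 1)"
  let ?e = "axis 1 1 :: complex^3" and ?f = "axis 2 1 :: complex^3"
  have "\<exists>u. u \<noteq> 0 \<and> det (?H u) = 0"
  proof (cases "det (?H ?f) = 0")
    case True
    then show ?thesis by (intro exI[of _ ?f]) simp
  next
    case False
    \<comment> \<open>The Hessian matrix of a cubic is linear in the point, so the middle matrix is
      set to 0 and the point found is \<open>?e + t\<^sup>2 *s ?f\<close>.\<close>
    obtain t where t: "det (\<chi> i j. ?H ?e$i$j + t * (0::complex^3^3)$i$j + t\<^sup>2 * ?H ?f$i$j) = 0"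
      using singular_in_pencil[OF False] .
    have "?e + t\<^sup>2 *s ?f \<noteq> 0"
      by (simp add: vec_eq_iff forall_3 axis_def)
    moreover have "det (?H (?e + t\<^sup>2 *s ?f)) = 0"
      using t by (simp add: add1 scale1)
    ultimately show ?thesis by blast
  qed
  then obtain u where u: "u \<noteq> 0" "det (?H u) = 0" by blast
  obtain w where w: "w \<noteq> 0" "\<And>a. T u w a = 0"
    using slot.kernel_if_det_zero[OF u(2)] by blast
  show thesis
  proof (cases "\<exists>k. w = k *s u")
    case True
    then obtain k where k: "w = k *s u" by blast
    with w have uu: "T u u a = 0" for a
      using scale2[of u k u a] by auto
    obtain q r where qr: "det3 u q r \<noteq> 0"
      using basis_ext1[OF u(1)] .
    have "aron T u q r = (T u r r * T u q q - (T u q r)\<^sup>2)\<^sup>2"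
      by (simp add: aron_def aronhold_def uu algebra_simps power2_eq_square)
    then have hess: "T u q q * T u r r = (T u q r)\<^sup>2"
      using S[OF qr] by (simp add: mult.commute)
    show thesis
      by (rule slot.square_if_degenerate[OF qr uu uu uu hess]) (rule that[OF u(1)])
  next
    case False
    then obtain r where r: "det3 u w r \<noteq> 0"
      using basis_ext2[OF u(1), of w] by blast
    \<comment> \<open>The conic \<open>T u\<close> has \<open>w\<close> in its radical and the conic
      \<open>T w\<close> has \<open>u\<close>; the two factors are the remaining minors of these
      conics.\<close>
    have "aron T u w r = (T u u u * T u r r - (T u u r)\<^sup>2) * (T w w w * T w r r - (T w w r)\<^sup>2)"
      using w(2)[of u] swap23[of u w u]
      by (simp add: aron_def aronhold_def w(2) algebra_simps power2_eq_square)
    then consider "T u u u * T u r r = (T u u r)\<^sup>2" | "T w w w * T w r r = (T w w r)\<^sup>2"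
      using S[OF r] by auto
    then show thesis
    proof cases
      case 1
      have b': "det3 w u r \<noteq> 0" using r by (simp add: det3_swap12[of u w])
      show thesis
        by (rule slot.square_if_degenerate[OF b' w(2) w(2) w(2) 1]) (rule that[OF u(1)])
    next
      case 2
      have wu: "T w u a = 0" for a using w(2)[of a] swap12[of w u a] by simp
      show thesis
        by (rule slot.square_if_degenerate[OF r wu wu wu 2]) (rule that[OF w(1)])
    qed
  qed
qed

end

section \<open>Quartics\<close>

text \<open>The difference of the two sides is a quadratic polynomial in \<open>x\<close>, the
  Hessian of a binary cubic. It vanishes at 0, 1 and -1, hence all three coefficients are
  zero.\<close>

lemma binary_hessian:
  fixes t0 t1 t2 t3 :: complex
  assumes "\<And>x. (t0 * x + t1) * (t2 * x + t3) = (t1 * x + t2)\<^sup>2"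
  shows "t0 * t2 = t1\<^sup>2" "t0 * t3 = t1 * t2" "t1 * t3 = t2\<^sup>2"
proof -
  have 0: "t1 * t3 = t2\<^sup>2"
    using assms[of 0] by simp
  have 1: "t0 * t2 + t0 * t3 + t1 * t2 + t1 * t3 = t1\<^sup>2 + 2 * t1 * t2 + t2\<^sup>2"
    using assms[of 1] by (simp add: algebra_simps power2_eq_square)
  have 2: "t0 * t2 - t0 * t3 - t1 * t2 + t1 * t3 = t1\<^sup>2 - 2 * t1 * t2 + t2\<^sup>2"
    using assms[of "-1"] by (simp add: algebra_simps power2_eq_square)
  have "2 * (t0 * t2) = 2 * t1\<^sup>2" "2 * (t0 * t3) = 2 * (t1 * t2)"
    using 0 1 2 by algebra+
  then show "t0 * t2 = t1\<^sup>2" "t0 * t3 = t1 * t2" "t1 * t3 = t2\<^sup>2"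
    using 0 by simp_all
qed

text \<open>The first factor is a quadratic with leading coefficient
  \<open>a * c - e\<^sup>2\<close>, which is nonzero, so the linear factor must be zero. Four values
  of the cubic product determine its coefficients.\<close>

lemma quadratic_times_linear:
  fixes a b c d e f l m :: complex
  assumes 0: "\<And>x. ((a * x + b) * (c * x + d) - (e * x + f)\<^sup>2) * (l * x + m) = 0"
    and "a * c \<noteq> e\<^sup>2"
  shows "l = 0" "m = 0"
proof -
  define h0 h1 h2 where "h0 = a * c - e\<^sup>2" "h1 = a * d + b * c - 2 * e * f" "h2 = b * d - f\<^sup>2"
  have *: "(h0 * x\<^sup>2 + h1 * x + h2) * (l * x + m) = 0" for x
    using 0[of x] unfolding h0_h1_h2_def by algebra
  have 1: "h2 * m = 0" "(h0 + h1 + h2) * (l + m) = 0" "(h0 - h1 + h2) * (m - l) = 0"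
    "(4 * h0 + 2 * h1 + h2) * (2 * l + m) = 0"
    using *[of 0] *[of 1] *[of "-1"] *[of 2] by (simp_all add: algebra_simps del: mult_eq_0_iff)
  then have "6 * (h0 * l) = 0" by algebra
  then show l: "l = 0" using assms(2) by (simp add: h0_h1_h2_def)
  from 1 have "2 * (h0 * m) = 0" unfolding l by algebra
  then show "m = 0" using assms(2) by (simp add: h0_h1_h2_def)
qed

text \<open>Symmetry in the last three arguments and one transposition involving the first generate
  all permutations, so \<open>M\<close> is linear and symmetric in all four.\<close>

locale sym_quadrilinear =
  fixes M :: "complex^3 \<Rightarrow> complex^3 \<Rightarrow> complex^3 \<Rightarrow> complex^3 \<Rightarrow> complex"
  assumes trilinear: "sym_trilinear (M u)"
    and swap_first: "M a b c e = M b a c e"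
begin

sublocale slot: sym_trilinear "M u" for u
  by (rule trilinear)

lemma add_first: "M (a + a') b c e = M a b c e + M a' b c e"
  by (metis swap_first slot.add1)

lemma diff_first: "M (a - a') b c e = M a b c e - M a' b c e"
  by (metis swap_first slot.diff1)

lemma scale_first: "M (k *s a) b c e = k * M a b c e"
  by (metis swap_first slot.scale1)

lemmas linear =
  add_first diff_first scale_first slot.expand slot.diff1 slot.diff2 slot.diff3

lemmas perm = swap_first slot.swap12 slot.swap23

text \<open>
  For the polarisation \<open>M\<close> of a quartic \<open>f\<close> this says that some directional derivative of \<open>f\<close> is a
  multiple of the cube of a linear form.
\<close>

definition cube_slot :: bool where
  "cube_slot \<longleftrightarrow> (\<exists>u n k. u \<noteq> 0 \<and> n \<noteq> 0 \<and>
     (\<forall>a b c. M u a b c = k * dot3 n a * dot3 n b * dot3 n c))"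

lemma cube_slotI:
  assumes "u \<noteq> 0" "det3 s y z \<noteq> 0"
    "M u s s s = 0" "M u s s y = 0" "M u s s z = 0" "M u s y y = 0" "M u s y z = 0" "M u s z z = 0"
    "M u y y y * M u y z z = (M u y y z)\<^sup>2" "M u y y y * M u z z z = M u y y z * M u y z z"
    "M u y y z * M u z z z = (M u y z z)\<^sup>2"
  shows cube_slot
  using slot.cube_if_degenerate[OF assms(2-11)] assms(1) unfolding cube_slot_def by metis

end

locale aronhold_null = sym_quadrilinear +
  assumes null: "det3 a b c \<noteq> 0 \<Longrightarrow> aron (M x) a b c = 0"
begin

text \<open>The condition at the point \<open>x *s p + y *s q + z *s r\<close>, written in the
  values of \<open>M\<close> on the basis. Later proofs specialise \<open>x\<close>,
  \<open>y\<close>, \<open>z\<close> to reach single coefficients of this quartic identity.\<close>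

lemma null_coords:
  assumes "det3 p q r \<noteq> 0"
  shows "aronhold
     (x * M p p p p + y * M p p p q + z * M p p p r)
     (x * M p p p r + y * M p p q r + z * M p p r r)
     (x * M p p r r + y * M p q r r + z * M p r r r)
     (x * M p r r r + y * M q r r r + z * M r r r r)
     (x * M p p p q + y * M p p q q + z * M p p q r)
     (x * M p p q r + y * M p q q r + z * M p q r r)
     (x * M p q r r + y * M q q r r + z * M q r r r)
     (x * M p p q q + y * M p q q q + z * M p q q r)
     (x * M p q q r + y * M q q q r + z * M q q r r)
     (x * M p q q q + y * M q q q q + z * M q q q r) = 0"
  using null[OF assms, of "x *s p + y *s q + z *s r"]
  by (simp add: aron_def linear perm)

lemma basis_nonzero:
  assumes "det3 p q r \<noteq> 0"
  shows "p \<noteq> 0" "q \<noteq> 0" "r \<noteq> 0"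
  using assms by auto

text \<open>
  In each case below, the vanishing of the Aronhold invariant along a suitable line is the vanishing
  of the Hessian of a binary cubic, which is \<open>M u\<close> for a vector \<open>u\<close> read off from the coefficients;
  the binary cubic is therefore a cube.
\<close>

lemma cube_slot_if_triple_root:
  assumes b: "det3 p q r \<noteq> 0"
    and z: "M p p p p = 0" "M p p p q = 0" "M p p p r = 0"
      "M p p q q = 0" "M p p q r = 0" "M p p r r = 0"
  shows cube_slot
proof -
  \<comment> \<open>At \<open>y *s q + r\<close> the arguments \<open>a0\<close>, \<open>a1\<close>
    and \<open>b0\<close> vanish, and the Aronhold invariant is the square of the Hessian of
    \<open>M p\<close>.\<close>
  have "(M p q q q * y + M p q q r) * (M p q r r * y + M p r r r) = (M p q q r * y + M p q r r)\<^sup>2" for y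
    using null_coords[OF b, of 0 y 1] unfolding aronhold_def z
    by simp algebra
  from binary_hessian[OF this] show ?thesis
    using z basis_nonzero[OF b] by (intro cube_slotI[of p p q r, OF _ b]) simp_all
qed

text \<open>Here \<open>f\<close> is, up to nonzero factors, \<open>x^4 + x y^3 + g(y, z)\<close>.
  The derivative along \<open>r\<close> kills both terms with \<open>x\<close>, and along
  \<open>p + q + z r\<close> the invariant is a nonzero multiple of its Hessian.\<close>

lemma cube_slot_quartic_plus_normalised:
  assumes b: "det3 p q r \<noteq> 0"
    and z: "M p p p q = 0" "M p p q q = 0" "M p p q r = 0" "M p p p r = 0" "M p p r r = 0"
      "M p q q r = 0" "M p q r r = 0" "M p r r r = 0"
    and nz: "M p p p p \<noteq> 0" "M p q q q \<noteq> 0"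
  shows cube_slot
proof -
  have H: "(M r r r r * z + M q r r r) * (M q q r r * z + M q q q r)
      = (M q r r r * z + M q q r r)\<^sup>2" for z
  proof -
    have "M p p p p * M p q q q * ((M r r r r * z + M q r r r) * (M q q r r * z + M q q q r)
      - (M q r r r * z + M q q r r)\<^sup>2) = 0"
      using null_coords[OF b, of 1 1 z] unfolding aronhold_def z
      by simp algebra
    then show ?thesis using nz by simp
  qed
  have b': "det3 p r q \<noteq> 0" using b by (simp add: det3_swap23[of p q])
  show ?thesis
    using z basis_nonzero[OF b] binary_hessian[OF H]
    by (intro cube_slotI[of r p r q, OF _ b']) (simp_all add: perm)
qed

text \<open>Here \<open>f\<close> has the shape \<open>x^4 + x c(y, z) + g(y, z)\<close>, and the
  binary cubic \<open>c\<close> has zero Hessian. If \<open>c\<close> is not 0, a shear or a swap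
  turns it into a multiple of \<open>y^3\<close>; if it is 0, the derivative along \<open>p\<close>
  is already a multiple of \<open>x^3\<close>.\<close>

lemma cube_slot_quartic_plus:
  assumes b: "det3 p q r \<noteq> 0"
    and z: "M p p p q = 0" "M p p q q = 0" "M p p q r = 0" "M p p p r = 0" "M p p r r = 0"
    and nz: "M p p p p \<noteq> 0"
  shows cube_slot
proof -
  have "(M p q q q * y + M p q q r) * (M p q r r * y + M p r r r) = (M p q q r * y + M p q r r)\<^sup>2" for y
    using null_coords[OF b, of 0 y 1] unfolding aronhold_def z
    by simp algebra
  note H = binary_hessian[OF this]
  show ?thesis
  proof (cases "M p q q q = 0")
    case False
    define t where "t = M p q q r / M p q q q"
    have t: "M p q q r = t * M p q q q" "M p q r r = t^2 * M p q q q" "M p r r r = t^3 * M p q q q"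
      using H False by (simp_all add: t_def field_simps power2_eq_square power3_eq_cube)
    have b': "det3 p q (r - t *s q) \<noteq> 0" using b by (simp add: det3_shear)
    show ?thesis
      by (rule cube_slot_quartic_plus_normalised[OF b'])
         (simp_all add: linear perm z t nz False algebra_simps power2_eq_square power3_eq_cube)
  next
    case True
    with H have t: "M p q q r = 0" "M p q r r = 0" by simp_all
    show ?thesis
    proof (cases "M p r r r = 0")
      case False
      have b': "det3 p r q \<noteq> 0" using b by (simp add: det3_swap23[of p q])
      show ?thesis
        by (rule cube_slot_quartic_plus_normalised[OF b'])
           (simp_all add: perm z t nz False True)
    next
      case zero: True
      have b': "det3 q p r \<noteq> 0" using b by (simp add: det3_swap12[of p q])
      show ?thesis
        by (rule cube_slotI[OF basis_nonzero(1)[OF b] b'])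
           (simp_all add: perm z t zero True)
    qed
  qed
qed

lemma cube_slot_double_root:
  assumes b: "det3 p q r \<noteq> 0"
    and z: "M p p p p = 0" "M p p p q = 0" "M p p p r = 0" "M p p q q = 0" "M p p q r = 0"
  shows cube_slot
proof (cases "M p p r r = 0")
  case True
  then show ?thesis using cube_slot_if_triple_root b z by blast
next
  case nz: False
  have S: "(x * M p p r r + M p q r r) * M p q q q = (M p q q r)\<^sup>2" for x
    using null_coords[OF b, of x 1 0] unfolding aronhold_def z
    by simp algebra
  have z3: "M p q q q = 0"
    using S[of 0] S[of 1] nz by (simp add: algebra_simps)
  have z4: "M p q q r = 0"
    using S[of 0] z3 by simp
  \<comment> \<open>Shearing \<open>q\<close> and \<open>r\<close> along \<open>p\<close> removes
    \<open>M p q r r\<close> and \<open>M p r r r\<close>. The 3 arises because \<open>r\<close>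
    fills three slots of the latter. What is left of \<open>f\<close> is a multiple of
    \<open>x^2 z^2\<close> plus a binary quartic in \<open>y, z\<close>.\<close>
  define B C where "B = M p q r r / M p p r r" "C = M p r r r / (3 * M p p r r)"
  then have BC: "M p q r r = B * M p p r r" "M p r r r = 3 * C * M p p r r"
    using nz by simp_all
  define q' r' where "q' = q - B *s p" "r' = r - C *s p"
  have b': "det3 p q' r' \<noteq> 0"
    using b by (simp add: q'_r'_def det3_def algebra_simps)
  have z': "M p p p p = 0" "M p p p q' = 0" "M p p p r' = 0" "M p p q' q' = 0" "M p p q' r' = 0"
    "M p q' q' q' = 0" "M p q' q' r' = 0" "M p q' r' r' = 0" "M p r' r' r' = 0"
    "M p p r' r' \<noteq> 0"
    by (simp_all add: q'_r'_def linear perm z z3 z4 BC nz algebra_simps)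
  have H: "(M q' q' q' q' * y + M q' q' q' r') * (M q' q' r' r' * y + M q' r' r' r')
     = (M q' q' q' r' * y + M q' q' r' r')\<^sup>2" for y
  proof -
    have "(M p p r' r')\<^sup>2 * ((M q' q' q' q' * y + M q' q' q' r') * (M q' q' r' r' * y + M q' r' r' r')
     - (M q' q' q' r' * y + M q' q' r' r')\<^sup>2) = 0"
      using null_coords[OF b', of 0 y 1] unfolding aronhold_def z'
      by simp algebra
    then show ?thesis using z' by simp
  qed
  show ?thesis
    by (rule cube_slotI[of q' p q' r', OF _ b'])
       (use z' binary_hessian[OF H] basis_nonzero[OF b'] in \<open>simp_all add: perm\<close>)
qed

text \<open>Along a suitable line the invariant is a quadratic, whose leading coefficient is nonzero
  by \<open>nz\<close>, times a polynomial of degree at most 1. By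
  \<open>quadratic_times_linear\<close> the second factor is zero.\<close>

lemma cube_slot_nondegenerate:
  assumes b: "det3 p q r \<noteq> 0"
    and z: "M p p p q = 0" "M p p q q = 0" "M p p q r = 0"
    and nz: "M p p p p * M p p r r \<noteq> (M p p p r)\<^sup>2"
    and t: "M p q q r = 0" "M p q q q = 0 \<or> M p q r r = 0"
  shows cube_slot
proof -
  consider "M p q q q = 0" "M p q r r = 0" | "M p q q q \<noteq> 0" "M p q r r = 0"
    | "M p q q q = 0" "M p q r r \<noteq> 0"
    using t by blast
  then show ?thesis
  proof cases
    case 1
    have H: "(M q q q q * y + M q q q r) * (M q q r r * y + M q r r r)
      = (M q q q r * y + M q q r r)\<^sup>2" for y
    proof -
      have *: "((M p p p p * x + M p p p r) * (M p p r r * x + M p r r r) - (M p p p r * x + M p p r r)\<^sup>2)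
        * (0 * x + ((M q q q q * y + M q q q r) * (M q q r r * y + M q r r r)
           - (M q q q r * y + M q q r r)\<^sup>2)) = 0" for x
        using null_coords[OF b, of x y 1] unfolding aronhold_def z t 1
        by simp algebra
      show ?thesis
        using quadratic_times_linear(2)[OF * nz] by simp
    qed
    show ?thesis
      by (rule cube_slotI[of q p q r, OF _ b])
         (use z t 1 binary_hessian[OF H] basis_nonzero[OF b] in \<open>simp_all add: perm\<close>)
  next
    case 2
    have *: "((M p p p p * x + M p p p r) * (M p p r r * x + M p r r r) - (M p p p r * x + M p p r r)\<^sup>2)
       * (M p q q q * M q r r r * x + (M q q q r * M q r r r - (M q q r r)\<^sup>2)) = 0" for x
      using null_coords[OF b, of x 0 1] unfolding aronhold_def z t 2
      by simp algebra
    have 0: "M q r r r = 0" "M q q r r = 0"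
      using quadratic_times_linear[OF * nz] 2 by simp_all
    \<comment> \<open>The choice makes \<open>M u q q q\<close> vanish, so \<open>q\<close> lies in
      the radical of \<open>M u\<close>. At \<open>x p + q + r\<close> the invariant is then minus
      the Hessian of the binary cubic \<open>M u\<close>.\<close>
    define k l where "k = M q q q r" "l = M p q q q"
    define u where "u = k *s p - l *s r"
    have u0: "u \<noteq> 0"
      using basis_indep[OF b, of k 0 "- l"] 2 by (auto simp: u_def k_l_def)
    have b': "det3 q p r \<noteq> 0" using b by (simp add: det3_swap12[of p q])
    have H: "(M u p p p * x + M u p p r) * (M u p r r * x + M u r r r) = (M u p p r * x + M u p r r)\<^sup>2" for x
    proof -
      have U: "M u p p p = k * M p p p p - l * M p p p r" "M u p p r = k * M p p p r - l * M p p r r"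
        "M u p r r = k * M p p r r - l * M p r r r" "M u r r r = k * M p r r r - l * M r r r r"
        by (simp_all add: u_def linear perm)
      show ?thesis
        using null_coords[OF b, of x 1 1] unfolding U aronhold_def z t 2 0 k_l_def
        by simp algebra
    qed
    show ?thesis
      by (rule cube_slotI[OF u0 b'])
         (use binary_hessian[OF H] in \<open>simp_all add: u_def linear perm z t 0 2 k_l_def\<close>)
  next
    case 3
    have *: "((M p p p p * x + 0) * (M p p r r * x + M p q r r) - (M p p p r * x + 0)\<^sup>2)
       * (M q q q q * M p q r r * x + (M q q q q * M q q r r - (M q q q r)\<^sup>2)) = 0" for x
      using null_coords[OF b, of x 1 0] unfolding aronhold_def z t 3
      by simp algebra
    have 0: "M q q q q = 0" "M q q q r = 0"
      using quadratic_times_linear[OF * nz] 3 by simp_all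
    \<comment> \<open>This time the choice cancels \<open>M u q r r\<close>, which puts
      \<open>q\<close> in the radical of \<open>M u\<close>; the Hessian of \<open>M u\<close>
      appears at \<open>x p + r\<close>.\<close>
    define k l where "k = M q q r r" "l = M p q r r"
    define u where "u = k *s p - l *s q"
    have u0: "u \<noteq> 0"
      using basis_indep[OF b, of k "- l" 0] 3 by (auto simp: u_def k_l_def)
    have b': "det3 q p r \<noteq> 0" using b by (simp add: det3_swap12[of p q])
    have H: "(M u p p p * x + M u p p r) * (M u p r r * x + M u r r r) = (M u p p r * x + M u p r r)\<^sup>2" for x
    proof -
      have U: "M u p p p = k * M p p p p - l * M p p p q" "M u p p r = k * M p p p r - l * M p p q r"
        "M u p r r = k * M p p r r - l * M p q r r" "M u r r r = k * M p r r r - l * M q r r r"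
        by (simp_all add: u_def linear perm)
      show ?thesis
        using null_coords[OF b, of x 0 1] unfolding U aronhold_def z t 3 0 k_l_def
        by simp algebra
    qed
    show ?thesis
      by (rule cube_slotI[OF u0 b'])
         (use binary_hessian[OF H] in \<open>simp_all add: u_def linear perm z t 0 3 k_l_def\<close>)
  qed
qed

text \<open>The vector \<open>q\<close> is in the kernel of \<open>M p p\<close>. The cases follow
  the rank of \<open>M p p\<close> on the span of \<open>p\<close> and \<open>r\<close>, with a
  shear of \<open>r\<close> to normalise.\<close>

lemma cube_slot_if_kernel:
  assumes b: "det3 p q r \<noteq> 0"
    and z: "M p p p q = 0" "M p p q q = 0" "M p p q r = 0"
  shows cube_slot
proof (cases "M p p p p * M p p r r = (M p p p r)\<^sup>2")
  case deg: True
  show ?thesis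
  proof (cases "M p p p p = 0")
    case True
    with deg have "M p p p r = 0" by simp
    then show ?thesis
      using cube_slot_double_root[OF b] True z by simp
  next
    case False
    define t where "t = M p p p r / M p p p p"
    have t: "M p p p r = t * M p p p p" "M p p r r = t^2 * M p p p p"
      using deg False by (simp_all add: t_def field_simps power2_eq_square)
    have b': "det3 p q (r - t *s p) \<noteq> 0" using b by (simp add: det3_shear)
    show ?thesis
      by (rule cube_slot_quartic_plus[OF b'])
         (simp_all add: linear perm z t False algebra_simps power2_eq_square)
  qed
next
  case nz: False
  have "(M p p p p * M p p r r - (M p p p r)\<^sup>2) * (M p q q q * M p q r r - (M p q q r)\<^sup>2) = 0"
    using null_coords[OF b, of 1 0 0] unfolding aronhold_def z
    by simp algebra
  then have H: "M p q q q * M p q r r = (M p q q r)\<^sup>2"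
    using nz by simp
  show ?thesis
  proof (cases "M p q q q = 0")
    case True
    then show ?thesis
      using cube_slot_nondegenerate[OF b z nz] H by simp
  next
    case False
    define t where "t = M p q q r / M p q q q"
    have t: "M p q q r = t * M p q q q" "M p q r r = t^2 * M p q q q"
      using H False by (simp_all add: t_def field_simps power2_eq_square)
    have b': "det3 p q (r - t *s q) \<noteq> 0" using b by (simp add: det3_shear)
    have e: "M p p p (r - t *s q) = M p p p r" "M p p (r - t *s q) (r - t *s q) = M p p r r"
      by (simp_all add: linear perm z)
    show ?thesis
      by (rule cube_slot_nondegenerate[OF b'])
         (use nz in \<open>unfold e, simp_all add: linear perm z t algebra_simps power2_eq_square\<close>)
  qed
qed

text \<open>At \<open>v\<close> the invariant is the square of the discriminant of
  \<open>M v v\<close> on \<open>q, r\<close>. So \<open>M v v\<close> has rank at most 1, and a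
  suitable basis leads to \<open>cube_slot_double_root\<close>.\<close>

lemma cube_slot_if_square_zero:
  assumes "v \<noteq> 0" and z: "\<And>a. M v v v a = 0"
  shows cube_slot
proof -
  obtain q r where b: "det3 v q r \<noteq> 0"
    using basis_ext1[OF assms(1)] .
  have "(M v v q q * M v v r r - (M v v q r)\<^sup>2)\<^sup>2 = 0"
    using null_coords[OF b, of 1 0 0] unfolding aronhold_def z
    by simp algebra
  then have H: "M v v q q * M v v r r = (M v v q r)\<^sup>2" by simp
  show ?thesis
  proof (cases "M v v r r = 0")
    case True
    with H have *: "M v v q r = 0" by simp
    have b': "det3 v r q \<noteq> 0" using b by (simp add: det3_swap23[of v q])
    show ?thesis
      by (rule cube_slot_double_root[OF b']) (simp_all add: z True * slot.slot.swap[of v v r q])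
  next
    case False
    define t where "t = M v v q r / M v v r r"
    have t: "M v v q r = t * M v v r r" "M v v q q = t^2 * M v v r r"
      using H False by (simp_all add: t_def field_simps power2_eq_square)
    have b': "det3 v (q - t *s r) r \<noteq> 0" using b by (simp add: det3_shear)
    show ?thesis
      by (rule cube_slot_double_root[OF b'])
         (simp_all add: z linear t slot.slot.swap[of v v r q] algebra_simps power2_eq_square)
  qed
qed

lemma cube_slot: cube_slot
proof -
  let ?H = "\<lambda>v. \<chi> i j. M v v (axis i 1) (axis j 1)"
  let ?e = "axis 1 1 :: complex^3" and ?f = "axis 2 1 :: complex^3"
  have "\<exists>v. v \<noteq> 0 \<and> det (?H v) = 0"
  proof (cases "det (?H ?f) = 0")
    case True
    then show ?thesis by (intro exI[of _ ?f]) simp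
  next
    case False
    \<comment> \<open>The second polar is quadratic in the point, so the cross term along
      \<open>?e + t *s ?f\<close> carries a factor 2.\<close>
    let ?B = "(\<chi> i j. 2 * M ?e ?f (axis i 1) (axis j 1)) :: complex^3^3"
    obtain t where t: "det (\<chi> i j. ?H ?e$i$j + t * ?B$i$j + t\<^sup>2 * ?H ?f$i$j) = 0"
      using singular_in_pencil[OF False] .
    have nz: "?e + t *s ?f \<noteq> 0"
      by (simp add: vec_eq_iff forall_3 axis_def)
    have eq: "?H (?e + t *s ?f) = (\<chi> i j. ?H ?e$i$j + t * ?B$i$j + t\<^sup>2 * ?H ?f$i$j)"
      by (simp add: vec_eq_iff linear swap_first[of ?f ?e] algebra_simps power2_eq_square)
    have "det (?H (?e + t *s ?f)) = 0"
      unfolding eq by (rule t)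
    with nz show ?thesis by blast
  qed
  then obtain v where v: "v \<noteq> 0" "det (?H v) = 0" by blast
  obtain w where w: "w \<noteq> 0" "\<And>a. M v v w a = 0"
    using slot.slot.kernel_if_det_zero[OF v(2)] by blast
  show ?thesis
  proof (cases "\<exists>k. w = k *s v")
    case True
    then obtain k where k: "w = k *s v" by blast
    with w have "M v v v a = 0" for a
      using slot.scale2[of v v k v a] w(2)[of a] by auto
    then show ?thesis
      by (rule cube_slot_if_square_zero[OF v(1)])
  next
    case False
    then obtain r where r: "det3 v w r \<noteq> 0"
      using basis_ext2[OF v(1), of w] by blast
    show ?thesis
      by (rule cube_slot_if_kernel[OF r]) (simp_all add: w(2) slot.slot.swap[of v v v w])
  qed
qed

end

section \<open>Directional derivatives of forms\<close>

definition dderiv :: "complex^3 \<Rightarrow> tform \<Rightarrow> tform" where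
  "dderiv u f = (\<lambda>t. u$1 * pd 1 f t + u$2 * pd 2 f t + u$3 * pd 3 f t)"

lemma dderiv_apply:
  "dderiv u f (i, j, k) = u$1 * (of_nat (Suc i) * f (Suc i, j, k))
     + u$2 * (of_nat (Suc j) * f (i, Suc j, k)) + u$3 * (of_nat (Suc k) * f (i, j, Suc k))"
  by (simp add: dderiv_def pd_def)

lemma dderiv_commute: "dderiv a (dderiv b f) = dderiv b (dderiv a f)"
proof
  fix t :: "nat \<times> nat \<times> nat"
  show "dderiv a (dderiv b f) t = dderiv b (dderiv a f) t"
    by (cases t) (simp add: dderiv_apply algebra_simps)
qed

lemma dderiv_add: "dderiv (a + b) f = (\<lambda>t. dderiv a f t + dderiv b f t)"
  and dderiv_scale: "dderiv (k *s a) f = (\<lambda>t. k * dderiv a f t)"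
  by (auto simp: dderiv_def algebra_simps)

lemma dderiv_std [simp]:
  "dderiv (vector [1,0,0]) f = pd 1 f" "dderiv (vector [0,1,0]) f = pd 2 f" "dderiv (vector [0,0,1]) f = pd 3 f"
  by (simp_all add: dderiv_def)

lemma feval_add: "feval d (\<lambda>t. f t + g t) v = feval d f v + feval d g v"
  by (simp add: feval_def sum.distrib algebra_simps)

lemma feval_scale: "feval d (\<lambda>t. k * f t) v = k * feval d f v"
  by (simp add: feval_def sum_distrib_left algebra_simps)

lemma feval_0: "feval 0 f v = f (0, 0, 0)"
  by (simp add: feval_def)

lemma feval_1: "feval 1 f v = dderiv v f (0, 0, 0)"
  by (simp add: feval_def dderiv_apply)

text \<open>Taylor expansion at 0: the m-fold derivative of a form of degree m in the direction
  \<open>v\<close> is m! times its value at \<open>v\<close>.\<close>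

lemma feval_2: "feval 2 f v = dderiv v (dderiv v f) (0, 0, 0) / 2"
  by (simp add: feval_def dderiv_apply eval_nat_numeral algebra_simps)

lemma feval_3: "feval 3 f v = dderiv v (dderiv v (dderiv v f)) (0, 0, 0) / 6"
  by (simp add: feval_def dderiv_apply eval_nat_numeral algebra_simps)

text \<open>The chain rule along a line. The bound on \<open>d\<close> allows the shift of indices
  between the two double sums to be checked by writing out all monomials.\<close>

lemma feval_has_derivative_le_4:
  assumes "1 \<le> d" "d \<le> 4"
  shows "((\<lambda>s. feval d f (w + s *s u)) has_field_derivative
           feval (d - 1) (dderiv u f) (w + s *s u)) (at s)"
proof -
  define X Y Z where "X = (\<lambda>s. w$1 + s * u$1)" "Y = (\<lambda>s. w$2 + s * u$2)" "Z = (\<lambda>s. w$3 + s * u$3)"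
  have XYZ: "(X has_field_derivative u$1) (at s)" "(Y has_field_derivative u$2) (at s)"
    "(Z has_field_derivative u$3) (at s)"
    unfolding X_Y_Z_def by (auto intro!: derivative_eq_intros)
  have eval: "feval m g (w + s *s u) = (\<Sum>i\<le>m. \<Sum>j\<le>m - i. g (i, j, m - i - j) * X s ^ i * Y s ^ j * Z s ^ (m - i - j))"
    for m g s
    by (simp add: feval_def X_Y_Z_def)
  have "((\<lambda>s. feval d f (w + s *s u)) has_field_derivative
     (\<Sum>i\<le>d. \<Sum>j\<le>d - i. f (i, j, d - i - j) * (
        of_nat i * X s ^ (i - 1) * u$1 * Y s ^ j * Z s ^ (d - i - j)
      + X s ^ i * (of_nat j * Y s ^ (j - 1) * u$2) * Z s ^ (d - i - j)
      + X s ^ i * Y s ^ j * (of_nat (d - i - j) * Z s ^ (d - i - j - 1) * u$3)))) (at s)"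
    unfolding eval
    by (intro DERIV_sum) (rule derivative_eq_intros XYZ refl | simp add: algebra_simps)+
  moreover consider "d = 1" | "d = 2" | "d = 3" | "d = 4"
    using assms by linarith
  then have "(\<Sum>i\<le>d. \<Sum>j\<le>d - i. f (i, j, d - i - j) * (
        of_nat i * X s ^ (i - 1) * u$1 * Y s ^ j * Z s ^ (d - i - j)
      + X s ^ i * (of_nat j * Y s ^ (j - 1) * u$2) * Z s ^ (d - i - j)
      + X s ^ i * Y s ^ j * (of_nat (d - i - j) * Z s ^ (d - i - j - 1) * u$3)))
      = feval (d - 1) (dderiv u f) (w + s *s u)"
    unfolding eval by cases (simp_all add: dderiv_apply eval_nat_numeral algebra_simps)
  ultimately show ?thesis by simp
qed

section \<open>Polar cubics and the Clebsch covariant\<close>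

definition polar :: "nat \<Rightarrow> tform \<Rightarrow> complex^3 \<Rightarrow> complex^3 \<Rightarrow> complex^3 \<Rightarrow> complex^3 \<Rightarrow> complex" where
  "polar d f x a b c = feval (d - 3) (dderiv a (dderiv b (dderiv c f))) x"

lemma sym_trilinear_polar: "sym_trilinear (polar d f x)"
  by standard
    (simp_all add: polar_def dderiv_add dderiv_scale feval_add feval_scale,
     simp_all add: dderiv_commute)

lemma clebsch_eq_aron:
  "clebsch d f v = aron (polar d f v) (vector [1,0,0]) (vector [0,1,0]) (vector [0,0,1])"
  by (simp add: clebsch_def aron_def aronhold_def polar_def d3_def Let_def)

lemma clebsch_zero_iff:
  assumes "det3 p q r \<noteq> 0"
  shows "clebsch d f v = 0 \<longleftrightarrow> aron (polar d f v) p q r = 0"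
  unfolding clebsch_eq_aron
  using sym_trilinear.aron_eq_0_any_basis[OF sym_trilinear_polar] assms det3_std zero_neq_one
  by metis

lemma clebsch_zero_if_degree_less_3:
  assumes "is_form d f" "d < 3"
  shows "clebsch d f v = 0"
proof -
  \<comment> \<open>Truncated subtraction gives \<open>d - 3 = 0\<close>, so only coefficients of
    total degree 3 are read, and these are 0 in a form of smaller degree.\<close>
  have "polar d f v a b c = 0" for a b c
    using assms by (simp add: polar_def feval_0 dderiv_apply is_form_def)
  then show ?thesis
    by (simp add: clebsch_eq_aron aron_def aronhold_def)
qed

section \<open>Split forms and the vanishing of their Clebsch covariant\<close>

definition cols :: "complex^3 \<Rightarrow> complex^3 \<Rightarrow> complex^3 \<Rightarrow> complex^3^3" where
  "cols p q r = (\<chi> i. vector [p$i, q$i, r$i])"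

lemma cols_mult: "cols p q r *v v = v$1 *s p + v$2 *s q + v$3 *s r"
  by (simp add: cols_def vec_eq_iff matrix_vector_mult_def sum_3 mult.commute)

lemma det_cols: "det (cols p q r) = det3 p q r"
  by (simp add: cols_def det3_def det_3 algebra_simps)

lemma split_form_iff_basis:
  "split_form d g \<longleftrightarrow> (\<exists>p q r. det3 p q r \<noteq> 0 \<and> (\<exists>\<alpha> b. \<forall>x y z.
     feval d g (x *s p + y *s q + z *s r) = (\<Sum>i\<le>d. \<alpha> i * x ^ i * y ^ (d - i)) + b * z ^ d))"
    (is "?L \<longleftrightarrow> ?R")
proof
  assume ?L
  then obtain A :: "complex^3^3" and \<alpha> b where A: "invertible A" and
    eq: "\<And>v. feval d g (A *v v) = (\<Sum>i\<le>d. \<alpha> i * (v$1) ^ i * (v$2) ^ (d - i)) + b * (v$3) ^ d"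
    unfolding split_form_def by blast
  have "A *v vector [x, y, z] = x *s column 1 A + y *s column 2 A + z *s column 3 A" for x y z
    by (simp add: vec_eq_iff matrix_vector_mult_def column_def sum_3 mult.commute)
  moreover have "det3 (column 1 A) (column 2 A) (column 3 A) = det A"
    by (simp add: det3_def det_3 column_def algebra_simps)
  ultimately show ?R
    using eq[of "vector [_, _, _]"] A unfolding invertible_det_nz
    by (intro exI[of _ "column 1 A"] exI[of _ "column 2 A"] exI[of _ "column 3 A"] conjI
        exI[of _ \<alpha>] exI[of _ b]) simp_all
next
  assume ?R
  then obtain p q r \<alpha> b where "det3 p q r \<noteq> 0" and
    "\<And>x y z. feval d g (x *s p + y *s q + z *s r) = (\<Sum>i\<le>d. \<alpha> i * x ^ i * y ^ (d - i)) + b * z ^ d"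
    by blast
  then show ?L
    unfolding split_form_def invertible_det_nz
    by (intro exI[of _ "cols p q r"] conjI exI[of _ \<alpha>] exI[of _ b])
       (simp_all add: cols_mult det_cols)
qed

text \<open>In the adapted basis the derivative along \<open>r\<close> is
  \<open>b d z^(d-1)\<close>, so third derivatives mixing \<open>r\<close> with \<open>p\<close> or
  \<open>q\<close> vanish, and every term of the Aronhold invariant contains one of them.\<close>

lemma clebsch_zero_if_split:
  assumes "d \<le> 4" "is_form d g" "split_form d g"
  shows "clebsch d g v = 0"
proof (cases "d < 3")
  case True
  then show ?thesis using clebsch_zero_if_degree_less_3 assms(2) by blast
next
  case False
  with assms(1) have d: "1 \<le> d" "1 \<le> d - 1" "1 \<le> d - 2" "d - 1 \<le> 4" "d - 2 \<le> 4" by auto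
  obtain p q r \<alpha> b where basis: "det3 p q r \<noteq> 0" and eq: "\<And>x y z.
      feval d g (x *s p + y *s q + z *s r) = (\<Sum>i\<le>d. \<alpha> i * x ^ i * y ^ (d - i)) + b * z ^ d"
    using assms(3) unfolding split_form_iff_basis by blast
  have 1: "feval (d - 1) (dderiv r g) (x *s p + y *s q + z *s r) = b * (of_nat d * z ^ (d - 1))" for x y z
  proof -
    have "feval d g ((x *s p + y *s q + z *s r) + s *s r)
        = (\<Sum>i\<le>d. \<alpha> i * x ^ i * y ^ (d - i)) + b * (z + s) ^ d" for s
      using eq[of x y "z + s"] by (simp add: vec.scale_left_distrib add.assoc)
    moreover have "((\<lambda>s. (\<Sum>i\<le>d. \<alpha> i * x ^ i * y ^ (d - i)) + b * (z + s) ^ d)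
        has_field_derivative b * (of_nat d * (z + 0) ^ (d - 1))) (at 0)"
      by (auto intro!: derivative_eq_intros)
    ultimately show ?thesis
      using DERIV_unique feval_has_derivative_le_4[OF d(1) assms(1), of g "x *s p + y *s q + z *s r" r 0]
      by fastforce
  qed
  have 2: "feval (d - 2) (dderiv a (dderiv r g)) v = 0" if a: "a = p \<or> a = q" for a v
  proof -
    obtain x y z where v: "v = x *s p + y *s q + z *s r"
      using basis_expand[OF basis] .
    have "feval (d - 1) (dderiv r g) (v + s *s a) = b * (of_nat d * z ^ (d - 1))" for s
      using a 1[of "x + s" y z] 1[of x "y + s" z] unfolding v
      by (auto simp: vec.scale_left_distrib algebra_simps)
    then show ?thesis
      using feval_has_derivative_le_4[OF d(2,4), of "dderiv r g" v a 0]
        DERIV_unique[OF _ DERIV_const] by (simp add: numeral_2_eq_2)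
  qed
  have "polar d g v e a r = 0" if a: "a = p \<or> a = q" for e a
    using feval_has_derivative_le_4[OF d(3,5), of "dderiv a (dderiv r g)" v e 0]
      DERIV_unique[OF _ DERIV_const] by (simp add: 2[OF a] polar_def numeral_3_eq_3)
  note 3 = this
  have "polar d g v p r r = 0" "polar d g v q r r = 0"
    using 3[of p r] 3[of q r] sym_trilinear.swap12[OF sym_trilinear_polar] by metis+
  then have "aron (polar d g v) p q r = 0"
    by (simp add: 3 aron_def aronhold_def)
  then show ?thesis
    using clebsch_zero_iff[OF basis] by blast
qed

lemma closed_clebsch_zero: "closed {f. \<forall>v. clebsch d f v = 0}"
proof -
  have pd: "continuous_on UNIV (pd a)" for a
  proof (intro continuous_on_coordinatewise_then_product)
    fix t :: "nat \<times> nat \<times> nat"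
    show "continuous_on UNIV (\<lambda>f. pd a f t)"
      by (cases t; cases "a = 1"; cases "a = 2")
         (auto simp: pd_def intro!: continuous_on_mult continuous_on_const)
  qed
  have "continuous_on UNIV (\<lambda>f. pd a (pd b (pd c f)))" for a b c
    by (rule continuous_on_compose2[OF pd continuous_on_compose2[OF pd pd]]) auto
  then have *: "continuous_on UNIV (\<lambda>f. pd a (pd b (pd c f)) t)" for a b c t
    by (rule continuous_on_product_then_coordinatewise)
  have "continuous_on UNIV (\<lambda>f. clebsch d f v)" for v
    unfolding clebsch_def d3_def feval_def Let_def
    by (intro continuous_intros *)
  then have "closed {f. clebsch d f v = 0}" for v
    by (rule closed_Collect_eq[OF _ continuous_on_const])
  then show ?thesis
    by (rule closed_Collect_all)
qed

section \<open>Limits of split forms\<close>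

text \<open>Closure properties of this predicate supply coefficient functions for products and
  linear substitutions without explicit formulas.\<close>

definition form_fun :: "nat \<Rightarrow> (complex^3 \<Rightarrow> complex) \<Rightarrow> bool" where
  "form_fun d F \<longleftrightarrow> (\<exists>c. is_form d c \<and> (\<forall>v. feval d c v = F v))"

lemma form_fun_add:
  assumes "form_fun d F" "form_fun d G"
  shows "form_fun d (\<lambda>v. F v + G v)"
proof -
  obtain c e where "is_form d c" "is_form d e" "\<And>v. feval d c v = F v" "\<And>v. feval d e v = G v"
    using assms unfolding form_fun_def by blast
  then show ?thesis
    unfolding form_fun_def by (intro exI[of _ "\<lambda>t. c t + e t"]) (simp add: is_form_def feval_add)
qed

lemma form_fun_scale:
  assumes "form_fun d F"
  shows "form_fun d (\<lambda>v. k * F v)"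
proof -
  obtain c where "is_form d c" "\<And>v. feval d c v = F v"
    using assms unfolding form_fun_def by blast
  then show ?thesis
    unfolding form_fun_def by (intro exI[of _ "\<lambda>t. k * c t"]) (simp add: is_form_def feval_scale)
qed

lemma form_fun_sum:
  assumes "finite A" "\<And>i. i \<in> A \<Longrightarrow> form_fun d (F i)"
  shows "form_fun d (\<lambda>v. \<Sum>i\<in>A. F i v)"
  using assms
proof (induction A rule: finite_induct)
  case empty
  have "is_form d (\<lambda>t. 0)" "\<And>v. feval d (\<lambda>t. 0) v = 0"
    by (simp_all add: is_form_def feval_def)
  then show ?case unfolding form_fun_def by auto
next
  case (insert x A)
  then show ?case by (simp add: form_fun_add)
qed

lemma form_fun_monomial:
  assumes "i + j + k = d"
  shows "form_fun d (\<lambda>v. (v$1) ^ i * (v$2) ^ j * (v$3) ^ k)"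
proof -
  define c :: tform where "c = (\<lambda>t. if t = (i, j, k) then 1 else 0)"
  have "feval d c v = (v$1) ^ i * (v$2) ^ j * (v$3) ^ k" for v
  proof -
    have "(\<Sum>j'\<le>d - i'. c (i', j', d - i' - j') * (v$1) ^ i' * (v$2) ^ j' * (v$3) ^ (d - i' - j'))
        = (if i' = i then (v$1) ^ i * (v$2) ^ j * (v$3) ^ k else 0)" for i'
    proof (cases "i' = i")
      case True
      have "(\<Sum>j'\<le>d - i. c (i, j', d - i - j') * (v$1) ^ i * (v$2) ^ j' * (v$3) ^ (d - i - j'))
          = (\<Sum>j'\<le>d - i. if j' = j then (v$1) ^ i * (v$2) ^ j * (v$3) ^ k else 0)"
        using assms by (intro sum.cong) (auto simp: c_def)
      then show ?thesis using True assms by simp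
    qed (simp add: c_def)
    then show ?thesis using assms by (simp add: feval_def)
  qed
  moreover have "is_form d c" using assms by (auto simp: is_form_def c_def)
  ultimately show ?thesis unfolding form_fun_def by blast
qed

lemma form_fun_mult:
  assumes "form_fun d F" "form_fun e G"
  shows "form_fun (d + e) (\<lambda>v. F v * G v)"
proof -
  obtain a b where F: "\<And>v. F v = feval d a v" and G: "\<And>v. G v = feval e b v"
    using assms unfolding form_fun_def by metis
  have monomial: "form_fun (d + e) (\<lambda>v. ((v$1) ^ i * (v$2) ^ j * (v$3) ^ k) * G v)"
    if "i + j + k = d" for i j k
  proof -
    have "((v$1) ^ i * (v$2) ^ j * (v$3) ^ k) * G v = (\<Sum>l\<le>e. \<Sum>m\<le>e - l. b (l, m, e - l - m) *
        ((v$1) ^ (i + l) * (v$2) ^ (j + m) * (v$3) ^ (k + (e - l - m))))" for v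
      unfolding G feval_def sum_distrib_left by (intro sum.cong refl) (simp only: power_add ac_simps)
    then show ?thesis
      using that by (auto intro!: form_fun_sum form_fun_scale form_fun_monomial)
  qed
  have "F v * G v = (\<Sum>i\<le>d. \<Sum>j\<le>d - i. a (i, j, d - i - j) *
      (((v$1) ^ i * (v$2) ^ j * (v$3) ^ (d - i - j)) * G v))" for v
    unfolding F feval_def sum_distrib_right by (simp add: mult.assoc)
  then show ?thesis
    by (auto intro!: form_fun_sum form_fun_scale monomial)
qed

lemma form_fun_1: "form_fun 0 (\<lambda>v. 1)"
  using form_fun_monomial[of 0 0 0 0] by simp

lemma form_fun_dot3: "form_fun 1 (dot3 n)"
proof -
  have "form_fun 1 (\<lambda>v. n$1 * v$1 + n$2 * v$2 + n$3 * v$3)"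
    using form_fun_monomial[of 1 0 0 1] form_fun_monomial[of 0 1 0 1] form_fun_monomial[of 0 0 1 1]
    by (intro form_fun_add form_fun_scale) simp_all
  then show ?thesis by (simp add: dot3_def[abs_def])
qed

lemma form_fun_dot3_power: "form_fun m (\<lambda>v. dot3 n v ^ m)"
proof (induction m)
  case 0
  then show ?case by (simp add: form_fun_1)
next
  case (Suc m)
  then show ?case using form_fun_mult[OF form_fun_dot3 Suc.IH] by simp
qed

lemma form_fun_substitute: "form_fun d (\<lambda>v. feval d f (A *v v))"
proof -
  have row: "(A *v v) $ i = dot3 (A $ i) v" for v :: "complex^3" and i
    by (simp add: matrix_vector_mult_def dot3_def sum_3)
  have "form_fun d (\<lambda>v. dot3 (A $ 1) v ^ i * dot3 (A $ 2) v ^ j * dot3 (A $ 3) v ^ (d - i - j))"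
    if "i \<le> d" "j \<le> d - i" for i j
    using form_fun_mult[OF form_fun_mult[OF form_fun_dot3_power[of i "A $ 1"]
        form_fun_dot3_power[of j "A $ 2"]] form_fun_dot3_power[of "d - i - j" "A $ 3"]] that by simp
  then show ?thesis
    unfolding feval_def row mult.assoc by (auto intro!: form_fun_sum form_fun_scale simp: mult.assoc)
qed

lemma feval_plane_binary:
  obtains \<alpha> where "\<And>x y. feval d f (x *s p + y *s q) = (\<Sum>i\<le>d. \<alpha> i * x ^ i * y ^ (d - i))"
proof -
  \<comment> \<open>The zero third column is harmless, since the substitution need not be
    invertible; on the plane only the coefficients without the third variable survive.\<close>
  obtain c where c: "\<And>v. feval d c v = feval d f (cols p q 0 *v v)"
    using form_fun_substitute[of d f "cols p q 0"] unfolding form_fun_def by blast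
  have "feval d f (x *s p + y *s q) = (\<Sum>i\<le>d. c (i, d - i, 0) * x ^ i * y ^ (d - i))" for x y
  proof -
    have "feval d f (x *s p + y *s q) = feval d c (vector [x, y, 0])"
      by (simp add: c cols_mult)
    also have "\<dots> = (\<Sum>i\<le>d. \<Sum>j\<le>d - i. if j = d - i then c (i, d - i, 0) * x ^ i * y ^ (d - i) else 0)"
      unfolding feval_def by (intro sum.cong) auto
    finally show ?thesis by simp
  qed
  then show thesis by (rule that)
qed

lemma is_const_if_DERIV_zero:
  fixes h :: "complex \<Rightarrow> complex"
  assumes "\<And>s. (h has_field_derivative 0) (at s)"
  shows "h s = h 0"
proof -
  obtain c where "\<And>x. h x = c"
    using has_field_derivative_zero_constant[of UNIV h] assms by auto
  then show ?thesis by simp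
qed

lemma in_closure_split_if_derivative_power:
  assumes d: "1 \<le> d" "d \<le> 4" and f: "is_form d f" and u: "u \<noteq> 0" and n: "n \<noteq> 0"
    and power: "\<And>v. feval (d - 1) (dderiv u f) v = k * dot3 n v ^ (d - 1)"
  shows "f \<in> closure {g. is_form d g \<and> split_form d g}"
proof (cases "dot3 n u = 0")
  case False
  obtain q0 r0 where b0: "det3 u q0 r0 \<noteq> 0"
    using basis_ext1[OF u] .
  \<comment> \<open>Projection along \<open>u\<close> into the kernel of \<open>n\<close>, so that
    \<open>n\<close> depends on the third coordinate only.\<close>
  define p q where "p = q0 - (dot3 n q0 / dot3 n u) *s u" "q = r0 - (dot3 n r0 / dot3 n u) *s u"
  have "det3 p q u = det3 u q0 r0"
    by (simp add: p_q_def det3_def algebra_simps)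
  then have basis: "det3 p q u \<noteq> 0" using b0 by simp
  have npq: "dot3 n p = 0" "dot3 n q = 0"
    using False by (simp_all add: p_q_def dot3_diff dot3_scale)
  obtain \<alpha> where \<alpha>: "\<And>x y. feval d f (x *s p + y *s q) = (\<Sum>i\<le>d. \<alpha> i * x ^ i * y ^ (d - i))"
    using feval_plane_binary by blast
  define c where "c = k * dot3 n u ^ (d - 1) / of_nat d"
  have "feval d f (x *s p + y *s q + z *s u) = (\<Sum>i\<le>d. \<alpha> i * x ^ i * y ^ (d - i)) + c * z ^ d" for x y z
  proof -
    have "((\<lambda>s. feval d f (x *s p + y *s q + s *s u) - c * s ^ d) has_field_derivative
        (feval (d - 1) (dderiv u f) (x *s p + y *s q + s *s u) - c * (of_nat d * s ^ (d - 1)))) (at s)" for s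
      by (intro DERIV_diff feval_has_derivative_le_4 d) (auto intro!: derivative_eq_intros)
    moreover have "feval (d - 1) (dderiv u f) (x *s p + y *s q + s *s u) - c * (of_nat d * s ^ (d - 1)) = 0" for s
      using d unfolding power by (simp add: dot3_add dot3_scale npq c_def power_mult_distrib)
    ultimately have "feval d f (x *s p + y *s q + z *s u) - c * z ^ d
        = feval d f (x *s p + y *s q + 0 *s u) - c * 0 ^ d"
      by (intro is_const_if_DERIV_zero) simp
    then show ?thesis using d by (simp add: \<alpha> power_0_left algebra_simps)
  qed
  then have "split_form d f"
    unfolding split_form_iff_basis using basis by blast
  then show ?thesis
    using f by (intro subsetD[OF closure_subset]) simp
next
  case True
  obtain p where p: "dot3 n p = 1"
  proof -
    obtain a where a: "dot3 n a \<noteq> 0"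
    proof -
      have "dot3 n (vector [1,0,0]) \<noteq> 0 \<or> dot3 n (vector [0,1,0]) \<noteq> 0 \<or> dot3 n (vector [0,0,1]) \<noteq> 0"
        using n by (auto simp: dot3_def vec_eq_iff forall_3)
      then show thesis using that by blast
    qed
    then show thesis
      by (intro that[of "(1 / dot3 n a) *s a"]) (simp add: dot3_scale)
  qed
  have "p \<noteq> k *s u" for k
    using p True by (auto simp: dot3_scale)
  then obtain q0 where q0: "det3 u p q0 \<noteq> 0"
    using basis_ext2[OF u] by blast
  define q where "q = q0 - dot3 n q0 *s p"
  have nq: "dot3 n q = 0"
    by (simp add: q_def dot3_diff dot3_scale p)
  have "det3 p q u = det3 u p q0"
    by (simp add: q_def det3_def algebra_simps)
  then have basis: "det3 p q u \<noteq> 0" using q0 by simp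
  obtain \<alpha> where \<alpha>: "\<And>x y. feval d f (x *s p + y *s q) = (\<Sum>i\<le>d. \<alpha> i * x ^ i * y ^ (d - i))"
    using feval_plane_binary by blast
  have f_eq: "feval d f (x *s p + y *s q + z *s u)
      = (\<Sum>i\<le>d. \<alpha> i * x ^ i * y ^ (d - i)) + k * x ^ (d - 1) * z" for x y z
  proof -
    have "((\<lambda>s. feval d f (x *s p + y *s q + s *s u) - k * x ^ (d - 1) * s) has_field_derivative
        (feval (d - 1) (dderiv u f) (x *s p + y *s q + s *s u) - k * x ^ (d - 1))) (at s)" for s
      by (intro DERIV_diff feval_has_derivative_le_4 d) (auto intro!: derivative_eq_intros)
    moreover have "feval (d - 1) (dderiv u f) (x *s p + y *s q + s *s u) - k * x ^ (d - 1) = 0" for s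
      unfolding power by (simp add: dot3_add dot3_scale nq p True)
    ultimately have "feval d f (x *s p + y *s q + z *s u) - k * x ^ (d - 1) * z
        = feval d f (x *s p + y *s q + 0 *s u) - k * x ^ (d - 1) * 0"
      by (intro is_const_if_DERIV_zero) simp
    then show ?thesis by (simp add: \<alpha> algebra_simps)
  qed
  obtain l where l: "dot3 l p = 1" "dot3 l q = 0" "dot3 l u = 0"
    using basis_functional[OF basis] by blast
  obtain m where m: "dot3 m p = 0" "dot3 m q = 0" "dot3 m u = 1"
    using basis_functional[OF basis] by blast
  have "\<exists>G. \<forall>j\<in>{..d}. is_form d (G j) \<and> (\<forall>v. feval d (G j) v = dot3 l v ^ (d - j) * dot3 m v ^ j)"
  proof (intro bchoice ballI)
    fix j assume "j \<in> {..d}"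
    then show "\<exists>c. is_form d c \<and> (\<forall>v. feval d c v = dot3 l v ^ (d - j) * dot3 m v ^ j)"
      using form_fun_mult[OF form_fun_dot3_power[of "d - j" l] form_fun_dot3_power[of j m]]
      by (simp add: form_fun_def)
  qed
  then obtain G where G: "\<And>j. j \<le> d \<Longrightarrow> is_form d (G j)"
    "\<And>j v. j \<le> d \<Longrightarrow> feval d (G j) v = dot3 l v ^ (d - j) * dot3 m v ^ j"
    by (metis atMost_iff)
  \<comment> \<open>In the coordinates of the basis \<open>p, q, u\<close> the form is \<open>\<alpha>(x, y) + k z x^(d-1)\<close>, the limit for \<open>e \<rightarrow> 0\<close>
    of \<open>\<alpha>(x, y) + k/(d e) ((x + e z)^d - x^d)\<close>; \<open>g e\<close> is this form, expanded so that it makes sense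
    for \<open>e = 0\<close>.\<close>
  define K where "K = k / of_nat d"
  define g where "g e t = f t + (\<Sum>j\<in>{2..d}. K * of_nat (d choose j) * e ^ (j - 1) * G j t)" for e t
  have g_form: "is_form d (g e)" for e
    using f G(1) by (auto simp: is_form_def g_def)
  have feval_sum: "feval d (\<lambda>t. \<Sum>j\<in>A. c j * G j t) v = (\<Sum>j\<in>A. c j * feval d (G j) v)"
    if "finite A" for A c v
    using that
    by (induction A rule: finite_induct) (simp_all add: feval_add feval_scale, simp add: feval_def)
  have g_eq: "feval d (g e) (x *s p + y *s q + z *s u)
      = (\<Sum>i\<le>d. \<alpha> i * x ^ i * y ^ (d - i)) + (K / e) * ((x + e * z) ^ d - x ^ d)"
    if e: "e \<noteq> 0" for e x y z
  proof -
    have split: "{..d} = insert 0 (insert 1 {2..d})" using d by auto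
    have "(x + e * z) ^ d = (\<Sum>j\<le>d. of_nat (d choose j) * (e * z) ^ j * x ^ (d - j))"
      using binomial_ring[of "e * z" x d] by (simp add: add.commute)
    also have "\<dots> = x ^ d + of_nat d * (e * z) * x ^ (d - 1)
        + (\<Sum>j\<in>{2..d}. of_nat (d choose j) * (e * z) ^ j * x ^ (d - j))"
      unfolding split by simp
    finally have "(K / e) * ((x + e * z) ^ d - x ^ d) = k * x ^ (d - 1) * z
        + (\<Sum>j\<in>{2..d}. (K / e) * (of_nat (d choose j) * (e * z) ^ j * x ^ (d - j)))"
      using e d by (simp add: K_def sum_distrib_left field_simps)
    moreover have "(K / e) * (of_nat (d choose j) * (e * z) ^ j * x ^ (d - j))
        = K * of_nat (d choose j) * e ^ (j - 1) * (x ^ (d - j) * z ^ j)" if "j \<in> {2..d}" for j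
    proof -
      have "e ^ j = e * e ^ (j - 1)" using that by (cases j) auto
      then show ?thesis using e by (simp add: power_mult_distrib)
    qed
    ultimately show ?thesis
      unfolding g_def feval_add
      by (simp add: feval_sum f_eq G(2) dot3_add dot3_scale l m)
  qed
  have g_split: "split_form d (g e)" if e: "e \<noteq> 0" for e
    unfolding split_form_iff_basis
  proof (intro exI conjI allI)
    \<comment> \<open>In this basis the new third coordinate is \<open>x + e * z\<close> in terms of
      the old ones, so its power becomes the separated summand.\<close>
    show "det3 (p - (1 / e) *s u) q ((1 / e) *s u) \<noteq> 0"
    proof -
      have "det3 (p - c *s u) q (c *s u) = c * det3 p q u" for c
        by (simp add: det3_def algebra_simps)
      then show ?thesis using basis e by simp
    qed
    fix x y z
    have "x *s (p - (1 / e) *s u) + y *s q + z *s ((1 / e) *s u) = x *s p + y *s q + ((z - x) / e) *s u"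
      by (simp add: vec_eq_iff diff_divide_distrib algebra_simps)
    moreover have "x + e * ((z - x) / e) = z" using e by simp
    ultimately have "feval d (g e) (x *s (p - (1 / e) *s u) + y *s q + z *s ((1 / e) *s u))
        = (\<Sum>i\<le>d. \<alpha> i * x ^ i * y ^ (d - i)) + (K / e) * (z ^ d - x ^ d)"
      by (simp only: g_eq[OF e])
    \<comment> \<open>The leftover \<open>- (K / e) * x ^ d\<close> is absorbed into the top
      coefficient of the binary part.\<close>
    also have "(\<Sum>i\<le>d. \<alpha> i * x ^ i * y ^ (d - i))
        = (\<Sum>i\<le>d. (\<alpha>(d := \<alpha> d - K / e)) i * x ^ i * y ^ (d - i)) + (K / e) * x ^ d"
    proof -
      have "(\<Sum>i\<le>d. (\<alpha>(d := \<alpha> d - K / e)) i * x ^ i * y ^ (d - i))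
          = (\<Sum>i\<le>d. \<alpha> i * x ^ i * y ^ (d - i) - (if i = d then (K / e) * x ^ d else 0))"
        by (intro sum.cong) (auto simp: algebra_simps)
      then show ?thesis by (simp add: sum_subtractf)
    qed
    finally show "feval d (g e) (x *s (p - (1 / e) *s u) + y *s q + z *s ((1 / e) *s u))
        = (\<Sum>i\<le>d. (\<alpha>(d := \<alpha> d - K / e)) i * x ^ i * y ^ (d - i)) + (K / e) * z ^ d"
      by (simp add: algebra_simps)
  qed
  have "continuous_on UNIV g"
    unfolding g_def by (intro continuous_on_coordinatewise_then_product continuous_intros)
  then have "(g \<longlongrightarrow> g 0) (at 0)"
    by (simp add: continuous_on_def)
  moreover have "g 0 = f"
    by (rule ext) (simp add: g_def power_0_left)
  ultimately have "(g \<longlongrightarrow> f) (at 0)" by simp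
  moreover have "g e \<in> closure {g. is_form d g \<and> split_form d g}" if "e \<noteq> 0" for e
    using g_form g_split[OF that] by (intro subsetD[OF closure_subset]) simp
  then have "eventually (\<lambda>e. g e \<in> closure {g. is_form d g \<and> split_form d g}) (at 0)"
    unfolding eventually_at_filter by (intro always_eventually) simp
  ultimately show ?thesis
    by (intro Lim_in_closed_set[OF closed_closure]) simp_all
qed

section \<open>The special derivative, degree by degree, and the equivalence\<close>

lemma derivative_power_if_clebsch_zero:
  assumes d: "1 \<le> d" "d \<le> 4" and null: "\<And>v. clebsch d f v = 0"
  obtains u n k where "u \<noteq> 0" "n \<noteq> 0"
    "\<And>v. feval (d - 1) (dderiv u f) v = k * dot3 n v ^ (d - 1)"
proof -
  let ?e = "vector [1, 0, 0] :: complex^3"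
  have e: "?e \<noteq> 0" by (simp add: vec_eq_iff forall_3)
  have aron0: "aron (polar d f x) a b c = 0" if "det3 a b c \<noteq> 0" for x a b c
    using clebsch_zero_iff[OF that, of d f x] null[of x] by simp
  consider "d = 1" | "d = 2" | "d = 3" | "d = 4" using d by linarith
  then show thesis
  proof cases
    case 1
    \<comment> \<open>The derivative is a constant and the power has exponent 0, so any nonzero
      \<open>n\<close> serves.\<close>
    show thesis
      by (rule that[OF e e, of "dderiv ?e f (0, 0, 0)"]) (simp add: 1 feval_0)
  next
    case 2
    define l :: "complex^3" where
      "l = vector [dderiv ?e f (1, 0, 0), dderiv ?e f (0, 1, 0), dderiv ?e f (0, 0, 1)]"
    have l: "feval 1 (dderiv ?e f) v = dot3 l v" for v
      unfolding feval_1 by (simp add: l_def dot3_def dderiv_apply[of v] mult.commute)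
    show thesis
    proof (cases "l = 0")
      case True
      show thesis
        by (rule that[OF e e, of 0]) (use l in \<open>simp add: 2 True dot3_def\<close>)
    next
      case False
      show thesis
        by (rule that[OF e False, of 1]) (use l in \<open>simp add: 2\<close>)
    qed
  next
    case 3
    \<comment> \<open>Third derivatives of a cubic are constant, so the base point 0 stands for
      every point.\<close>
    interpret T: sym_trilinear "polar 3 f 0" by (rule sym_trilinear_polar)
    obtain u n k where u: "u \<noteq> 0" "n \<noteq> 0" and eq: "\<And>a b. polar 3 f 0 u a b = k * dot3 n a * dot3 n b"
      using T.square_slot_if_aron_zero aron0[unfolded 3] by metis
    have "feval (d - 1) (dderiv u f) v = (k / 2) * dot3 n v ^ (d - 1)" for v
    proof -
      have "feval (d - 1) (dderiv u f) v = polar 3 f 0 v v u / 2"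
        by (simp add: 3 feval_2 polar_def feval_0)
      also have "polar 3 f 0 v v u = polar 3 f 0 u v v"
        using T.swap12 T.swap23 by metis
      finally show ?thesis by (simp add: eq 3 power2_eq_square)
    qed
    then show thesis by (rule that[OF u])
  next
    case 4
    \<comment> \<open>Third derivatives of a quartic are linear in the point, which therefore acts
      as a fourth direction of differentiation.\<close>
    have M: "polar 4 f x a b c = dderiv x (dderiv a (dderiv b (dderiv c f))) (0, 0, 0)" for x a b c
      using feval_1 by (simp add: polar_def)
    interpret M: aronhold_null "polar 4 f"
    proof (intro aronhold_null.intro sym_quadrilinear.intro aronhold_null_axioms.intro)
      show "sym_trilinear (polar 4 f u)" for u by (rule sym_trilinear_polar)
      show "polar 4 f a b c e = polar 4 f b a c e" for a b c e
        by (simp only: M dderiv_commute[of a b])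
      show "aron (polar 4 f x) a b c = 0" if "det3 a b c \<noteq> 0" for x a b c
        using aron0[OF that] 4 by simp
    qed
    obtain u n k where u: "u \<noteq> 0" "n \<noteq> 0"
      and eq: "\<And>a b c. polar 4 f u a b c = k * dot3 n a * dot3 n b * dot3 n c"
      using M.cube_slot unfolding M.cube_slot_def by blast
    have "feval (d - 1) (dderiv u f) v = (k / 6) * dot3 n v ^ (d - 1)" for v
    proof -
      have "feval (d - 1) (dderiv u f) v = polar 4 f v v v u / 6"
        by (simp add: 4 feval_3 M)
      also have "polar 4 f v v v u = polar 4 f u v v v"
        by (simp only: M dderiv_commute[of v u])
      finally show ?thesis by (simp add: eq 4 power3_eq_cube)
    qed
    then show thesis by (rule that[OF u])
  qed
qed

lemma split_form_degree_0: "split_form 0 f"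
proof -
  have "invertible (mat 1 :: complex^3^3)"
    by (simp add: invertible_det_nz)
  then show ?thesis
    unfolding split_form_def feval_0
    by (intro exI[of _ "mat 1"] conjI exI[of _ "\<lambda>_. 0"] exI[of _ "f (0, 0, 0)"]) simp_all
qed

theorem theorem8p1:
  fixes d :: nat and f :: tform
  assumes "d \<le> 4" and "is_form d f"
  shows "(\<forall>v. clebsch d f v = 0) \<longleftrightarrow>
         f \<in> closure {g. is_form d g \<and> split_form d g}"
proof
  assume null: "\<forall>v. clebsch d f v = 0"
  show "f \<in> closure {g. is_form d g \<and> split_form d g}"
  proof (cases "d = 0")
    case True
    then show ?thesis
      using assms(2) split_form_degree_0 by (intro subsetD[OF closure_subset]) simp
  next
    case False
    then have "1 \<le> d" by simp
    then obtain u n k where "u \<noteq> 0" "n \<noteq> 0"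
      "\<And>v. feval (d - 1) (dderiv u f) v = k * dot3 n v ^ (d - 1)"
      using derivative_power_if_clebsch_zero[of d f] assms(1) null by blast
    then show ?thesis
      by (rule in_closure_split_if_derivative_power[OF \<open>1 \<le> d\<close> assms])
  qed
next
  assume "f \<in> closure {g. is_form d g \<and> split_form d g}"
  moreover have "closure {g. is_form d g \<and> split_form d g} \<subseteq> {g. \<forall>v. clebsch d g v = 0}"
    using clebsch_zero_if_split[OF assms(1)]
    by (intro closure_minimal closed_clebsch_zero) blast
  ultimately show "\<forall>v. clebsch d f v = 0" by blast
qed

end
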